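(* For all integers $m\ge 3$, $n\ge 1$ and $1\le k\le m-1$, the type II melting lollipop graph $\Gamma_{m,n}^{(k)}$, obtained from the lollipop graph $L_{m,n}$ by deleting the edges between vertex $1$ and the vertices $m,m-1,\dots,m-k+1$, is $e$-positive.
   Context: The lollipop graph $L_{m,n}$ is the graph with vertex set $\{1,\dots,m+n\}$ in which $1,\dots,m$ are pairwise adjacent, and for each $i$ with $m+1\le i\le m+n$ the vertex $i$ is adjacent to $i-1$; there are no other edges. (Equivalently, it is the labelled unit interval graph in which the smallest label $w_i$ in the closed neighbourhood of $i$ is $w_i=1$ for $1\le i\le m$ and $w_i=i-1$ for $m+1\le i\le m+n$.) The chromatic symmetric function of a finite simple graph $G$ is $X_G=\sum_\kappa\prod_{v\in V(G)}x_{\kappa(v)}$ (commuting variables), summed over all proper colourings $\kappa:V(G)\to\mathbb Z_{>0}$. With $e_i=\sum_{j_1<\cdots<j_i}x_{j_1}\cdots x_{j_i}$ and $e_\lambda=\prod_i e_{\lambda_i}$, $G$ is $e$-positive if $X_G$ expands in the basis $\{e_\lambda\}$ of symmetric functions over $\mathbb Q$ with all coefficients nonnegative. *)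

theory Defs
  imports Complex_Main "HOL-Library.Multiset" "HOL-Library.FuncSet"
begin

section \<open>Formal power series in the variables \<open>x\<^sub>j\<close>, \<open>j :: nat\<close>\<close>

text \<open>
  A monomial is encoded as the multiset of the indices of its variables:
  \<open>x\<^sub>1 * x\<^sub>1 * x\<^sub>3\<close> is \<open>{#1, 1, 3#}\<close>, and the product of monomials is the sum of multisets.
  A power series is an arbitrary family of coefficients indexed by monomials.
\<close>

typedef 'a mps = "UNIV :: (nat multiset \<Rightarrow> 'a) set"
  morphisms mcoeff Abs_mps ..

setup_lifting type_definition_mps

lemma mps_eqI: "(\<And>M. mcoeff f M = mcoeff g M) \<Longrightarrow> f = g"
  by transfer auto

lemma finite_splits: "finite {(A, B). A + B = (M :: 'b multiset)}"
proof -
  have "finite {A. A \<subseteq># M}"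
  proof (rule finite_subset)
    show "{A. A \<subseteq># M} \<subseteq> mset ` {xs. set xs \<subseteq> set_mset M \<and> length xs \<le> size M}"
    proof
      fix A assume "A \<in> {A. A \<subseteq># M}"
      moreover obtain xs where "A = mset xs" using ex_mset by metis
      ultimately show "A \<in> mset ` {xs. set xs \<subseteq> set_mset M \<and> length xs \<le> size M}"
        using set_mset_mono[of A M] size_mset_mono[of A M] by auto
    qed
  qed (simp add: finite_lists_length_le)
  hence "finite ({A. A \<subseteq># M} \<times> {A. A \<subseteq># M})" by simp
  thus ?thesis by (rule rev_finite_subset) auto
qed

instantiation mps :: (comm_ring_1) comm_ring_1
begin

lift_definition zero_mps :: "'a mps" is "\<lambda>M. 0" .
lift_definition one_mps :: "'a mps" is "\<lambda>M. if M = {#} then 1 else 0" .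
lift_definition plus_mps :: "'a mps \<Rightarrow> 'a mps \<Rightarrow> 'a mps" is "\<lambda>f g M. f M + g M" .
lift_definition uminus_mps :: "'a mps \<Rightarrow> 'a mps" is "\<lambda>f M. - f M" .
lift_definition minus_mps :: "'a mps \<Rightarrow> 'a mps \<Rightarrow> 'a mps" is "\<lambda>f g M. f M - g M" .
lift_definition times_mps :: "'a mps \<Rightarrow> 'a mps \<Rightarrow> 'a mps" is
  "\<lambda>f g M. \<Sum>(A, B) | A + B = M. f A * g B" .

instance
proof
  fix a b c :: "'a mps"
  show "a * b * c = a * (b * c)"
  proof (transfer, rule ext)
    fix a b c :: "nat multiset \<Rightarrow> 'a" and M :: "nat multiset"
    have "(\<Sum>(P, C) | P + C = M. (\<Sum>(A, B) | A + B = P. a A * b B) * c C)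
        = (\<Sum>p\<in>{(P, C). P + C = M}. \<Sum>q\<in>{(A, B). A + B = fst p}.
             a (fst q) * b (snd q) * c (snd p))"
      by (intro sum.cong) (auto simp: sum_distrib_right case_prod_unfold)
    also have "\<dots> = (\<Sum>(p, q)\<in>Sigma {(P, C). P + C = M} (\<lambda>p. {(A, B). A + B = fst p}).
             a (fst q) * b (snd q) * c (snd p))"
      by (rule sum.Sigma) (auto simp: finite_splits)
    also have "\<dots> = (\<Sum>(p, q)\<in>Sigma {(A, Q). A + Q = M} (\<lambda>p. {(B, C). B + C = snd p}).
             a (fst p) * (b (fst q) * c (snd q)))"
      by (rule sum.reindex_bij_witness
            [where i = "\<lambda>(p, q). ((fst p + fst q, snd q), (fst p, fst q))"
               and j = "\<lambda>(p, q). ((fst q, snd q + snd p), (snd q, snd p))"])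
         (auto simp: algebra_simps)
    also have "\<dots> = (\<Sum>p\<in>{(A, Q). A + Q = M}. \<Sum>q\<in>{(B, C). B + C = snd p}.
             a (fst p) * (b (fst q) * c (snd q)))"
      by (rule sum.Sigma [symmetric]) (auto simp: finite_splits)
    also have "\<dots> = (\<Sum>(A, Q) | A + Q = M. a A * (\<Sum>(B, C) | B + C = Q. b B * c C))"
      by (intro sum.cong) (auto simp: sum_distrib_left case_prod_unfold)
    finally show "(\<Sum>(P, C) | P + C = M. (\<Sum>(A, B) | A + B = P. a A * b B) * c C)
      = (\<Sum>(A, Q) | A + Q = M. a A * (\<Sum>(B, C) | B + C = Q. b B * c C))" .
  qed
  show "a * b = b * a"
  proof (transfer, rule ext)
    fix a b :: "nat multiset \<Rightarrow> 'a" and M :: "nat multiset"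
    show "(\<Sum>(A, B) | A + B = M. a A * b B) = (\<Sum>(A, B) | A + B = M. b A * a B)"
      by (rule sum.reindex_bij_witness[where i = prod.swap and j = prod.swap])
         (auto simp: algebra_simps)
  qed
  show "1 * a = a"
  proof (transfer, rule ext)
    fix a :: "nat multiset \<Rightarrow> 'a" and M :: "nat multiset"
    have "(\<Sum>(A, B) | A + B = M. (if A = {#} then 1 else 0) * a B)
        = (\<Sum>(A, B)\<in>{({#} :: nat multiset, M)}. (if A = {#} then 1 else 0) * a B)"
      by (rule sum.mono_neutral_right) (auto simp: finite_splits split: if_splits)
    thus "(\<Sum>(A, B) | A + B = M. (if A = {#} then 1 else 0) * a B) = a M" by simp
  qed
  show "(a + b) * c = a * c + b * c"
    by (transfer, rule ext)
       (simp add: sum.distrib[symmetric] case_prod_unfold distrib_right)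
  show "(0 :: 'a mps) \<noteq> 1"
    by transfer (auto simp: fun_eq_iff)
qed (transfer; simp add: fun_eq_iff algebra_simps)+

end

lemma mcoeff_sum: "mcoeff (sum F S) M = (\<Sum>s\<in>S. mcoeff (F s) M)"
  by (induction S rule: infinite_finite_induct) (auto simp: zero_mps.rep_eq plus_mps.rep_eq)

lift_definition mps_scale :: "'a :: comm_ring_1 \<Rightarrow> 'a mps \<Rightarrow> 'a mps" is "\<lambda>c f M. c * f M" .


section \<open>Elementary symmetric functions\<close>

text \<open>
  The variables in use are \<open>x\<^sub>1, x\<^sub>2, \<dots>\<close>.  Each finite set \<open>J\<close> of \<open>i\<close> positive indices
  contributes the monomial \<open>mset_set J\<close>; the coefficient of \<open>M\<close> counts the sets contributing \<open>M\<close>.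
\<close>

lift_definition elem_sym :: "nat \<Rightarrow> rat mps" is
  "\<lambda>i M. of_nat (card {J. J \<subseteq> {1..} \<and> finite J \<and> card J = i \<and> mset_set J = M})" .

lemma finite_elem_sym_fibre:
  "finite {J :: nat set. J \<subseteq> {1..} \<and> finite J \<and> card J = i \<and> mset_set J = M}"
  by (rule finite_subset[of _ "{set_mset M}"]) auto

text \<open>A partition is encoded as the multiset of its parts, all of them positive.\<close>

definition partitions :: "nat multiset set" where
  "partitions = {lam. 0 \<notin># lam}"

definition elem_sym_part :: "nat multiset \<Rightarrow> rat mps" where
  "elem_sym_part lam = (\<Prod>i\<in>#lam. elem_sym i)"


section \<open>Chromatic symmetric functions\<close>

type_synonym 'v graph = "'v set \<times> 'v set set"

definition finite_simple_graph :: "'v graph \<Rightarrow> bool" where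
  "finite_simple_graph G \<longleftrightarrow>
     finite (fst G) \<and> (\<forall>e\<in>snd G. e \<subseteq> fst G \<and> card e = 2)"

definition proper_colourings :: "'v graph \<Rightarrow> ('v \<Rightarrow> nat) set" where
  "proper_colourings G =
     {\<kappa> \<in> fst G \<rightarrow>\<^sub>E {1..}. \<forall>u v. {u, v} \<in> snd G \<longrightarrow> \<kappa> u \<noteq> \<kappa> v}"

text \<open>
  The monomial \<open>\<Prod>v\<in>V. x\<^bsub>\<kappa> v\<^esub>\<close> is the multiset of the colours \<open>\<kappa> v\<close>; the coefficient of \<open>M\<close>
  counts the proper colourings with that monomial.
\<close>

lift_definition chromatic_sym :: "'v graph \<Rightarrow> rat mps" is
  "\<lambda>G M. of_nat (card {\<kappa> \<in> proper_colourings G. image_mset \<kappa> (mset_set (fst G)) = M})" .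

lemma finite_chromatic_fibre:
  assumes "finite (fst G)"
  shows "finite {\<kappa> \<in> proper_colourings G. image_mset \<kappa> (mset_set (fst G)) = M}"
proof (rule finite_subset)
  show "{\<kappa> \<in> proper_colourings G. image_mset \<kappa> (mset_set (fst G)) = M}
        \<subseteq> fst G \<rightarrow>\<^sub>E set_mset M"
    using assms by (auto simp: proper_colourings_def PiE_iff extensional_def)
qed (use assms in \<open>auto intro: finite_PiE\<close>)

text \<open>
  Since the \<open>elem_sym_part lam\<close> with \<open>lam \<in> partitions\<close> are linearly independent, there is at most
  one finitely supported \<open>c\<close> as below.
\<close>

definition e_positive :: "'v graph \<Rightarrow> bool" where
  "e_positive G \<longleftrightarrow>
     (\<exists>c :: nat multiset \<Rightarrow> rat.
        finite {lam \<in> partitions. c lam \<noteq> 0} \<and>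
        chromatic_sym G =
          (\<Sum>lam | lam \<in> partitions \<and> c lam \<noteq> 0. mps_scale (c lam) (elem_sym_part lam)) \<and>
        (\<forall>lam\<in>partitions. 0 \<le> c lam))"


section \<open>Lollipop graphs\<close>

definition lollipop :: "nat \<Rightarrow> nat \<Rightarrow> nat graph" where
  "lollipop m n =
     ({1..m + n},
      {{i, j} | i j. 1 \<le> i \<and> i < j \<and> j \<le> m} \<union> {{i - 1, i} | i. m + 1 \<le> i \<and> i \<le> m + n})"

definition delete_edges :: "'v graph \<Rightarrow> 'v set set \<Rightarrow> 'v graph" where
  "delete_edges G F = (fst G, snd G - F)"

text \<open>For \<open>k \<le> m - 1\<close>, the range \<open>{m - k + 1..m}\<close> consists of \<open>k\<close> neighbours of vertex \<open>1\<close>.\<close>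

definition melting_lollipop :: "nat \<Rightarrow> nat \<Rightarrow> nat \<Rightarrow> nat graph" where
  "melting_lollipop m n k =
     delete_edges (lollipop m n) {{1, j} | j. m - k + 1 \<le> j \<and> j \<le> m}"

lemma finite_simple_graph_lollipop:
  assumes "1 \<le> m"
  shows "finite_simple_graph (lollipop m n)"
proof -
  have "card {i - 1, i} = 2" if "m + 1 \<le> i" for i
    using that assms by (auto simp: card_insert_if)
  thus ?thesis
    using assms by (auto simp: finite_simple_graph_def lollipop_def)
qed

lemma finite_simple_graph_melting_lollipop:
  assumes "1 \<le> m"
  shows "finite_simple_graph (melting_lollipop m n k)"
  using finite_simple_graph_lollipop[OF assms, of n]
  by (auto simp: finite_simple_graph_def melting_lollipop_def delete_edges_def)

end

theory Submission
  imports Defs "HOL-Combinatorics.Transposition"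
begin

text \<open>
  Let \<open>T\<close> be a clique of \<open>H\<close> whose vertices are interchangeable, \<open>v \<notin> T\<close>, and let \<open>X\<^sub>S\<close> be the
  chromatic symmetric function of \<open>H\<close> with \<open>v\<close> joined to \<open>S \<subseteq> T\<close>.  A proper colouring of \<open>H\<close> gives
  \<open>v\<close> the colour of at most one vertex of \<open>T\<close>, so \<open>X\<^sub>S = X\<^bsub>{}\<^esub> - \<bar>S\<bar> Y\<close>, where \<open>Y\<close> counts the colourings in
  which \<open>v\<close> shares the colour of a fixed vertex of \<open>T\<close>.  Hence \<open>X\<^sub>S\<close> is a convex combination of
  \<open>X\<^bsub>{}\<^esub>\<close> and \<open>X\<^sub>T\<close>.

  Joining the first path vertex to one or to all vertices of the clique of \<open>L\<^bsub>m,n\<^esub>\<close> yields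
  \<open>L\<^bsub>m,n\<^esub>\<close> and \<open>L\<^bsub>m+1,n-1\<^esub>\<close>, so lollipops are e-positive by induction on \<open>n\<close>.  With \<open>v = m\<close> and
  \<open>S = {2..m-1}\<close> inside the clique \<open>T = {1..m-1}\<close> one gets the lollipop without the edge \<open>{1, m}\<close>, and
  with \<open>v = 1\<close>, \<open>S = {2..m-k}\<close> and \<open>T = {2..m-1}\<close> the melting lollipop.
\<close>

section \<open>The cone of e-positive series\<close>

lemma mps_scale_add_right: "mps_scale a (f + g) = mps_scale a f + mps_scale a g"
  by transfer (simp add: fun_eq_iff algebra_simps)

lemma mps_scale_add_left: "mps_scale (a + b) f = mps_scale a f + mps_scale b f"
  by transfer (simp add: fun_eq_iff algebra_simps)

lemma mps_scale_mps_scale: "mps_scale a (mps_scale b f) = mps_scale (a * b) f"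
  by transfer (simp add: fun_eq_iff algebra_simps)

lemma mps_scale_zero_right [simp]: "mps_scale a 0 = 0"
  by transfer simp

lemma mps_scale_zero_left [simp]: "mps_scale 0 f = 0"
  by transfer simp

lemma mps_scale_one [simp]: "mps_scale 1 f = f"
  by transfer simp

lemma mps_scale_mult_left: "mps_scale a f * g = mps_scale a (f * g)"
  by transfer (simp add: fun_eq_iff sum_distrib_left case_prod_unfold mult.assoc)

lemma mps_scale_mult_right: "f * mps_scale a g = mps_scale a (f * g)"
  by (metis mps_scale_mult_left mult.commute)

lemma elem_sym_part_union: "elem_sym_part (lam + mu) = elem_sym_part lam * elem_sym_part mu"
  by (simp add: elem_sym_part_def)

text \<open>Building the cone one nonnegative term at a time turns each closure property into an
  induction; repeated partitions stay unmerged.\<close>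

inductive_set e_cone :: "rat mps set" where
  zero: "0 \<in> e_cone"
| add_part: "f \<in> e_cone \<Longrightarrow> lam \<in> partitions \<Longrightarrow> 0 \<le> a \<Longrightarrow>
    f + mps_scale a (elem_sym_part lam) \<in> e_cone"

lemma e_cone_add: "g \<in> e_cone \<Longrightarrow> f \<in> e_cone \<Longrightarrow> f + g \<in> e_cone"
  by (induction g rule: e_cone.induct) (auto simp flip: add.assoc intro: e_cone.intros)

lemma e_cone_scale: "f \<in> e_cone \<Longrightarrow> 0 \<le> a \<Longrightarrow> mps_scale a f \<in> e_cone"
  by (induction f rule: e_cone.induct)
    (auto simp: mps_scale_add_right mps_scale_mps_scale intro: e_cone.intros)

text \<open>The parts of \<open>lam\<close> and \<open>mu\<close> together form a partition again,
  and nonnegative coefficients multiply.\<close>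

lemma e_cone_mult_part:
  assumes "f \<in> e_cone" "mu \<in> partitions" "0 \<le> b"
  shows "f * mps_scale b (elem_sym_part mu) \<in> e_cone"
  using assms
proof (induction f rule: e_cone.induct)
  case (add_part f lam a)
  have "lam + mu \<in> partitions" "0 \<le> b * a"
    using add_part by (auto simp: partitions_def)
  from e_cone.add_part[OF add_part.IH[OF add_part.prems] this] show ?case
    by (simp add: distrib_right mps_scale_add_right mps_scale_mult_left mps_scale_mult_right
        mps_scale_mps_scale elem_sym_part_union)
qed (auto intro: e_cone.zero)

lemma e_cone_mult: "g \<in> e_cone \<Longrightarrow> f \<in> e_cone \<Longrightarrow> f * g \<in> e_cone"
  by (induction g rule: e_cone.induct)
    (auto simp: distrib_left intro: e_cone.zero e_cone_add e_cone_mult_part)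

lemma elem_sym_in_e_cone:
  assumes "i > 0"
  shows "elem_sym i \<in> e_cone"
proof -
  have "0 + mps_scale 1 (elem_sym_part {#i#}) \<in> e_cone"
    by (rule e_cone.intros)+ (use assms in \<open>auto simp: partitions_def\<close>)
  thus ?thesis by (simp add: elem_sym_part_def)
qed

text \<open>Merges repeated partitions: a new term at \<open>mu\<close> only raises the coefficient
  there. This supplies the coefficient function that \<open>e_positive\<close> asks for.\<close>

lemma e_cone_expansion:
  assumes "f \<in> e_cone"
  shows "\<exists>c :: nat multiset \<Rightarrow> rat. finite {lam \<in> partitions. c lam \<noteq> 0} \<and>
     f = (\<Sum>lam | lam \<in> partitions \<and> c lam \<noteq> 0. mps_scale (c lam) (elem_sym_part lam)) \<and>
     (\<forall>lam\<in>partitions. 0 \<le> c lam)"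
  using assms
proof (induction f rule: e_cone.induct)
  case zero
  show ?case by (rule exI[of _ "\<lambda>_. 0"]) simp
next
  case (add_part f mu a)
  then obtain c :: "nat multiset \<Rightarrow> rat" where
    fin: "finite {lam \<in> partitions. c lam \<noteq> 0}" and
    f: "f = (\<Sum>lam | lam \<in> partitions \<and> c lam \<noteq> 0. mps_scale (c lam) (elem_sym_part lam))" and
    nn: "\<forall>lam\<in>partitions. 0 \<le> c lam" by blast
  define d where "d = c(mu := c mu + a)"
  \<comment> \<open>\<open>S\<close> covers the supports of both \<open>c\<close> and
    \<open>d\<close>, so both expansions can be written over it, padded by zero terms.\<close>
  define S where "S = insert mu {lam \<in> partitions. c lam \<noteq> 0}"
  have sub: "{lam \<in> partitions. d lam \<noteq> 0} \<subseteq> S" and S: "finite S" "S \<subseteq> partitions" "mu \<in> S"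
    using fin add_part.hyps by (auto simp: d_def S_def split: if_splits)
  have "f = (\<Sum>lam\<in>S. mps_scale (c lam) (elem_sym_part lam))"
    unfolding f by (rule sum.mono_neutral_left) (use S in \<open>auto simp: S_def\<close>)
  also have "\<dots> = mps_scale (c mu) (elem_sym_part mu)
      + (\<Sum>lam\<in>S - {mu}. mps_scale (c lam) (elem_sym_part lam))"
    using S by (simp add: sum.remove)
  also have "(\<Sum>lam\<in>S - {mu}. mps_scale (c lam) (elem_sym_part lam))
      = (\<Sum>lam\<in>S - {mu}. mps_scale (d lam) (elem_sym_part lam))"
    by (intro sum.cong) (auto simp: d_def)
  finally have "f + mps_scale a (elem_sym_part mu) = mps_scale (d mu) (elem_sym_part mu)
      + (\<Sum>lam\<in>S - {mu}. mps_scale (d lam) (elem_sym_part lam))"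
    by (simp add: d_def mps_scale_add_left algebra_simps)
  also have "\<dots> = (\<Sum>lam\<in>S. mps_scale (d lam) (elem_sym_part lam))"
    using S by (simp add: sum.remove)
  also have "\<dots> = (\<Sum>lam | lam \<in> partitions \<and> d lam \<noteq> 0. mps_scale (d lam) (elem_sym_part lam))"
    by (rule sum.mono_neutral_right) (use S sub in auto)
  finally have "f + mps_scale a (elem_sym_part mu)
      = (\<Sum>lam | lam \<in> partitions \<and> d lam \<noteq> 0. mps_scale (d lam) (elem_sym_part lam))" .
  moreover have "\<forall>lam\<in>partitions. 0 \<le> d lam"
    using nn add_part.hyps by (auto simp: d_def)
  ultimately show ?case
    using finite_subset[OF sub S(1)] by blast
qed

lemma e_positiveI: "chromatic_sym G \<in> e_cone \<Longrightarrow> e_positive G"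
  using e_cone_expansion unfolding e_positive_def by blast


section \<open>Chromatic symmetric functions of unions and cliques\<close>

lemma mcoeff_chromatic_sym:
  "mcoeff (chromatic_sym (V, E)) M
    = of_nat (card {\<kappa> \<in> proper_colourings (V, E). image_mset \<kappa> (mset_set V) = M})"
  by (simp add: chromatic_sym.rep_eq)

lemma image_mset_mset_set_cong:
  assumes "\<And>x. x \<in> V \<Longrightarrow> f x = g x"
  shows "image_mset f (mset_set V) = image_mset g (mset_set V)"
  by (cases "finite V") (auto intro!: image_mset_cong simp: assms)

text \<open>A proper colouring of the union is an independent pair of proper colourings whose
  monomials multiply; sorting the pairs by their two monomials gives the Cauchy product.\<close>

lemma chromatic_sym_disjoint_union:
  assumes fin: "finite V" "finite W" and disj: "V \<inter> W = {}"
    and E: "\<Union>E \<subseteq> V" and F: "\<Union>F \<subseteq> W"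
  shows "chromatic_sym (V \<union> W, E \<union> F) = chromatic_sym (V, E) * chromatic_sym (W, F)"
proof (rule mps_eqI)
  fix M
  define P where "P V E A = {\<kappa> \<in> proper_colourings (V :: 'a set, E). image_mset \<kappa> (mset_set V) = A}"
    for V E and A :: "nat multiset"
  \<comment> \<open>\<open>?Q\<close> holds what the coefficient of \<open>M\<close> in the product
    counts. \<open>?h\<close> glues two colourings; \<open>?g\<close> splits one and reads the
    factorisation of \<open>M\<close> off the two pieces.\<close>
  let ?Q = "SIGMA p:{(A, B). A + B = M}. P V E (fst p) \<times> P W F (snd p)"
  let ?h = "\<lambda>(p :: nat multiset \<times> nat multiset, \<kappa>, \<mu>) x. if x \<in> V then \<kappa> x else (\<mu> x :: nat)"
  let ?g = "\<lambda>\<kappa>. ((image_mset \<kappa> (mset_set V), image_mset \<kappa> (mset_set W)), restrict \<kappa> V, restrict \<kappa> W)"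
  have finP: "finite (P V E A)" "finite (P W F A)" for A
    using finite_chromatic_fibre[of "(V, E)" A] finite_chromatic_fibre[of "(W, F)" A] fin
    by (auto simp: P_def)
  have VW: "mset_set (V \<union> W) = mset_set V + mset_set W"
    using fin disj by (rule mset_set_Union)
  have inE: "u \<in> V" "w \<in> V" if "{u, w} \<in> E" for u w
    using that E by auto
  have inF: "u \<in> W" "w \<in> W" if "{u, w} \<in> F" for u w
    using that F by auto
  have hV: "image_mset (?h (p, \<kappa>, \<mu>)) (mset_set V) = image_mset \<kappa> (mset_set V)" for p \<kappa> \<mu>
    by (rule image_mset_mset_set_cong) simp
  have hW: "image_mset (?h (p, \<kappa>, \<mu>)) (mset_set W) = image_mset \<mu> (mset_set W)" for p \<kappa> \<mu>
    by (rule image_mset_mset_set_cong) (use disj in auto)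
  have r: "image_mset (restrict \<kappa> U) (mset_set U) = image_mset \<kappa> (mset_set U)"
    for \<kappa> :: "'a \<Rightarrow> nat" and U
    by (rule image_mset_mset_set_cong) simp
  have g: "?g \<kappa> \<in> ?Q" if "\<kappa> \<in> P (V \<union> W) (E \<union> F) M" for \<kappa>
    using that by (auto simp: P_def proper_colourings_def r VW PiE_iff dest: inE inF)
  have h: "?h q \<in> P (V \<union> W) (E \<union> F) M" if q: "q \<in> ?Q" for q
  proof -
    obtain A B \<kappa> \<mu> where q_eq: "q = ((A, B), \<kappa>, \<mu>)" by (metis prod.collapse)
    have k: "\<kappa> \<in> proper_colourings (V, E)" "\<mu> \<in> proper_colourings (W, F)"
      and m: "image_mset \<kappa> (mset_set V) + image_mset \<mu> (mset_set W) = M"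
      using q by (auto simp: q_eq P_def)
    \<comment> \<open>Outside \<open>V \<union> W\<close> the glued map falls back to
      \<open>\<mu>\<close>, which is \<open>undefined\<close> there.\<close>
    have "?h q \<in> V \<union> W \<rightarrow>\<^sub>E {1..}"
      using k by (auto simp: q_eq proper_colourings_def PiE_iff extensional_def)
    moreover have "?h q u \<noteq> ?h q w" if "{u, w} \<in> E" for u w
      using k inE[OF that] that by (auto simp: q_eq proper_colourings_def)
    moreover have "?h q u \<noteq> ?h q w" if "{u, w} \<in> F" for u w
      using k inF[OF that] that disj by (auto simp: q_eq proper_colourings_def)
    moreover have "image_mset (?h q) (mset_set (V \<union> W)) = M"
      unfolding VW image_mset_union q_eq hV hW by (rule m)
    ultimately show ?thesis by (auto simp: P_def proper_colourings_def)
  qed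
  have "bij_betw ?g (P (V \<union> W) (E \<union> F) M) ?Q"
  proof (rule bij_betw_byWitness[where f' = ?h])
    show "\<forall>\<kappa>\<in>P (V \<union> W) (E \<union> F) M. ?h (?g \<kappa>) = \<kappa>"
      by (auto simp: P_def proper_colourings_def PiE_iff extensional_def fun_eq_iff)
    show "\<forall>q\<in>?Q. ?g (?h q) = q"
    proof
      fix q assume q: "q \<in> ?Q"
      obtain A B \<kappa> \<mu> where q_eq: "q = ((A, B), \<kappa>, \<mu>)" by (metis prod.collapse)
      have k: "\<kappa> \<in> V \<rightarrow>\<^sub>E {1..}" "\<mu> \<in> W \<rightarrow>\<^sub>E {1..}"
        and m: "image_mset \<kappa> (mset_set V) = A" "image_mset \<mu> (mset_set W) = B"
        using q by (auto simp: q_eq P_def proper_colourings_def)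
      have "restrict (?h q) V = \<kappa>" "restrict (?h q) W = \<mu>"
        using k disj by (auto simp: q_eq fun_eq_iff PiE_iff extensional_def)
      thus "?g (?h q) = q"
        unfolding q_eq hV hW m by simp
    qed
  qed (use g h in blast)+
  hence "card (P (V \<union> W) (E \<union> F) M) = card ?Q"
    by (rule bij_betw_same_card)
  also have "\<dots> = (\<Sum>p | fst p + snd p = M. card (P V E (fst p)) * card (P W F (snd p)))"
    using finite_splits[of M]
    by (subst card_SigmaI) (auto simp: finP card_cartesian_product case_prod_unfold)
  finally show "mcoeff (chromatic_sym (V \<union> W, E \<union> F)) M
      = mcoeff (chromatic_sym (V, E) * chromatic_sym (W, F)) M"
    by (simp add: times_mps.rep_eq mcoeff_chromatic_sym case_prod_unfold flip: P_def)
qed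

lemma e_cone_disjoint_union:
  assumes "finite V" "finite W" "V \<inter> W = {}" "\<Union>E \<subseteq> V" "\<Union>F \<subseteq> W"
    and "chromatic_sym (V, E) \<in> e_cone" "chromatic_sym (W, F) \<in> e_cone"
  shows "chromatic_sym (V \<union> W, E \<union> F) \<in> e_cone"
  using assms by (simp add: chromatic_sym_disjoint_union e_cone_mult)

section \<open>Complete graphs\<close>

definition clique_edges :: "'v set \<Rightarrow> 'v set set" where
  "clique_edges C = {{i, j} | i j. i \<in> C \<and> j \<in> C \<and> i \<noteq> j}"

lemma doubleton_in_clique_edges: "{u, w} \<in> clique_edges C \<longleftrightarrow> u \<in> C \<and> w \<in> C \<and> u \<noteq> w"
  by (auto simp: clique_edges_def doubleton_eq_iff)

lemma proper_colourings_clique: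
  "proper_colourings (C, clique_edges C) = {\<kappa> \<in> C \<rightarrow>\<^sub>E {1..}. inj_on \<kappa> C}"
  by (auto simp: proper_colourings_def doubleton_in_clique_edges inj_on_def)

lemma card_inj_on_PiE_fact:
  assumes "finite C" "finite J" "card J = card C"
  shows "card {\<kappa> \<in> C \<rightarrow>\<^sub>E J. inj_on \<kappa> C} = fact (card C)"
  using card_inj_on_subset_funcset[of C J C] assms
  by (simp add: fact_prod_rev)

text \<open>Proper colourings of a clique are the injective ones, and each set of
  \<open>card C\<close> colours is the image of \<open>fact (card C)\<close> of them.\<close>

lemma chromatic_sym_clique:
  assumes fin: "finite C"
  shows "chromatic_sym (C, clique_edges C) = mps_scale (fact (card C)) (elem_sym (card C))"
proof (rule mps_eqI)
  fix M :: "nat multiset"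
  define K where "K = {\<kappa> \<in> C \<rightarrow>\<^sub>E {1..}. inj_on \<kappa> C \<and> image_mset \<kappa> (mset_set C) = M}"
  define \<J> where "\<J> = {J :: nat set. J \<subseteq> {1..} \<and> finite J \<and> card J = card C \<and> mset_set J = M}"
  \<comment> \<open>A monomial determines its set of variables, so \<open>\<J>\<close> has at most
    one element.\<close>
  have "card K = fact (card C) * card \<J>"
  proof (cases "\<J> = {}")
    case True
    have "K = {}"
    proof (rule ccontr)
      assume "K \<noteq> {}"
      then obtain \<kappa> where "\<kappa> \<in> C \<rightarrow>\<^sub>E {1..}" "inj_on \<kappa> C" "image_mset \<kappa> (mset_set C) = M"
        by (auto simp: K_def)
      hence "\<kappa> ` C \<in> \<J>"
        using fin by (auto simp: \<J>_def card_image image_mset_mset_set)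
      thus False using True by simp
    qed
    thus ?thesis using True by simp
  next
    case False
    then obtain J where J: "J \<subseteq> {1..}" "finite J" "card J = card C" "mset_set J = M"
      by (auto simp: \<J>_def)
    have \<J>: "\<J> = {J}"
      using J by (auto simp: \<J>_def)
    \<comment> \<open>An injective colouring has monomial \<open>M\<close> iff its image is
      \<open>J\<close>; as \<open>card J = card C\<close>, landing inside \<open>J\<close> is
      enough.\<close>
    have "\<kappa> \<in> K \<longleftrightarrow> \<kappa> \<in> C \<rightarrow>\<^sub>E J" if inj: "inj_on \<kappa> C" for \<kappa>
    proof -
      have "image_mset \<kappa> (mset_set C) = M \<longleftrightarrow> mset_set (\<kappa> ` C) = mset_set J"
        using inj J(4) by (simp add: image_mset_mset_set)
      also have "\<dots> \<longleftrightarrow> \<kappa> ` C = J"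
        using fin J(2) by (simp add: mset_set_eq_iff)
      also have "\<dots> \<longleftrightarrow> \<kappa> ` C \<subseteq> J"
        using card_subset_eq[OF J(2), of "\<kappa> ` C"] card_image[OF inj] J(3) by auto
      finally show ?thesis
        using inj J(1) by (auto simp: K_def PiE_iff image_subset_iff)
    qed
    hence "K = {\<kappa> \<in> C \<rightarrow>\<^sub>E J. inj_on \<kappa> C}"
      by (auto simp: K_def)
    thus ?thesis using \<J> card_inj_on_PiE_fact[OF fin J(2,3)] by simp
  qed
  thus "mcoeff (chromatic_sym (C, clique_edges C)) M
      = mcoeff (mps_scale (fact (card C)) (elem_sym (card C))) M"
    by (simp add: mcoeff_chromatic_sym proper_colourings_clique mps_scale.rep_eq elem_sym.rep_eq
        K_def \<J>_def conj_assoc)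
qed

lemma clique_in_e_cone:
  assumes "finite C" "C \<noteq> {}"
  shows "chromatic_sym (C, clique_edges C) \<in> e_cone"
  using assms by (simp add: chromatic_sym_clique e_cone_scale elem_sym_in_e_cone card_gt_0_iff)


section \<open>Attaching a vertex to part of a clique\<close>

definition star_edges :: "'v \<Rightarrow> 'v set \<Rightarrow> 'v set set" where
  "star_edges v S = (\<lambda>a. {v, a}) ` S"

lemma doubleton_in_star_edges: "{u, w} \<in> star_edges v S \<longleftrightarrow> u = v \<and> w \<in> S \<or> w = v \<and> u \<in> S"
  by (auto simp: star_edges_def doubleton_eq_iff image_iff)

lemma proper_colourings_star:
  "proper_colourings (V, E \<union> star_edges v S)
    = {\<kappa> \<in> proper_colourings (V, E). \<forall>a\<in>S. \<kappa> v \<noteq> \<kappa> a}"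
  by (auto simp: proper_colourings_def doubleton_in_star_edges)

text \<open>One \<open>Y\<close> serves every \<open>S\<close>, so that different \<open>S\<close>
  can be compared. Invariance of \<open>E\<close> under transpositions is what makes the vertices of
  \<open>T\<close> interchangeable.\<close>

lemma chromatic_sym_star:
  fixes E :: "'v set set"
  assumes fin: "finite V" and T: "T \<subseteq> V" "v \<in> V" "v \<notin> T"
    and clique: "\<And>a b. a \<in> T \<Longrightarrow> b \<in> T \<Longrightarrow> a \<noteq> b \<Longrightarrow> {a, b} \<in> E"
    and sym: "\<And>a b u w. a \<in> T \<Longrightarrow> b \<in> T \<Longrightarrow> {u, w} \<in> E \<Longrightarrow>
      {transpose a b u, transpose a b w} \<in> E"
  obtains Y where "\<And>S. S \<subseteq> T \<Longrightarrow>
    chromatic_sym (V, E) = chromatic_sym (V, E \<union> star_edges v S) + mps_scale (of_nat (card S)) Y"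
proof (cases "T = {}")
  \<comment> \<open>\<open>Y\<close> will refer to a chosen vertex of \<open>T\<close>; if there is
    none, \<open>S\<close> is empty and \<open>0\<close> will do.\<close>
  case True
  show thesis
    by (rule that[of 0]) (use True in \<open>simp add: star_edges_def\<close>)
next
  case False
  then obtain t where t: "t \<in> T" by blast
  define P where "P = (\<lambda>M. {\<kappa> \<in> proper_colourings (V, E). image_mset \<kappa> (mset_set V) = M})"
  define Q where "Q = (\<lambda>a M. {\<kappa> \<in> P M. \<kappa> v = \<kappa> a})"
  define Y where "Y = Abs_mps (\<lambda>M. of_nat (card (Q t M)) :: rat)"
  have finP: "finite (P M)" for M
    using finite_chromatic_fibre[of "(V, E)" M] fin by (simp add: P_def)
  \<comment> \<open>Exchanging the colours of \<open>a\<close> and \<open>b\<close> permutes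
    \<open>V\<close>, so the monomial survives; \<open>sym\<close> keeps the colouring proper, and
    \<open>v\<close> keeps its colour because it lies outside \<open>T\<close>.\<close>
  have swap: "\<kappa> \<circ> transpose a b \<in> Q b M" if "\<kappa> \<in> Q a M" "a \<in> T" "b \<in> T" for \<kappa> a b M
  proof -
    have ab: "a \<in> V" "b \<in> V" "v \<noteq> a" "v \<noteq> b" using that T by auto
    have "image_mset (\<kappa> \<circ> transpose a b) (mset_set V)
        = image_mset \<kappa> (image_mset (transpose a b) (mset_set V))"
      by (simp add: multiset.map_comp)
    also have "image_mset (transpose a b) (mset_set V) = mset_set V"
      using ab by (simp add: image_mset_mset_set)
    also have "image_mset \<kappa> (mset_set V) = M"
      using that by (simp add: Q_def P_def)
    finally have "image_mset (\<kappa> \<circ> transpose a b) (mset_set V) = M" .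
    moreover have "\<kappa> \<circ> transpose a b \<in> V \<rightarrow>\<^sub>E {1..}"
      using that ab by (auto simp: Q_def P_def proper_colourings_def PiE_iff extensional_def
          transpose_def)
    moreover have "(\<kappa> \<circ> transpose a b) u \<noteq> (\<kappa> \<circ> transpose a b) w" if "{u, w} \<in> E" for u w
      using sym[OF \<open>a \<in> T\<close> \<open>b \<in> T\<close> that] \<open>\<kappa> \<in> Q a M\<close>
      by (auto simp: Q_def P_def proper_colourings_def)
    moreover have "(\<kappa> \<circ> transpose a b) v = (\<kappa> \<circ> transpose a b) b"
      using \<open>\<kappa> \<in> Q a M\<close> ab by (simp add: Q_def transpose_def)
    ultimately show ?thesis
      by (auto simp: Q_def P_def proper_colourings_def)
  qed
  have card_Q: "card (Q a M) = card (Q t M)" if "a \<in> T" for a M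
  proof (rule bij_betw_same_card)
    have inv: "\<kappa> \<circ> transpose a b \<circ> transpose b a = \<kappa>" for \<kappa> :: "'v \<Rightarrow> nat" and a b
      by (auto simp: fun_eq_iff transpose_def)
    show "bij_betw (\<lambda>\<kappa>. \<kappa> \<circ> transpose a t) (Q a M) (Q t M)"
    proof (rule bij_betw_byWitness[where f' = "\<lambda>\<kappa>. \<kappa> \<circ> transpose t a"])
      show "(\<lambda>\<kappa>. \<kappa> \<circ> transpose a t) ` Q a M \<subseteq> Q t M"
        by (intro image_subsetI swap that t)
      show "(\<lambda>\<kappa>. \<kappa> \<circ> transpose t a) ` Q t M \<subseteq> Q a M"
        by (intro image_subsetI swap that t)
    qed (intro ballI inv)+
  qed
  show thesis
  proof (rule that[of Y])
    fix S assume S: "S \<subseteq> T"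
    show "chromatic_sym (V, E)
        = chromatic_sym (V, E \<union> star_edges v S) + mps_scale (of_nat (card S)) Y"
    proof (rule mps_eqI)
      fix M
      have finS: "finite S" by (rule finite_subset[OF _ fin]) (use S T in blast)
      \<comment> \<open>Two vertices of the clique never share a colour, so \<open>v\<close> agrees
        with at most one of them.\<close>
      have disj: "Q a M \<inter> Q b M = {}" if "a \<in> S" "b \<in> S" "a \<noteq> b" for a b
      proof -
        have "{a, b} \<in> E" using clique that S by auto
        hence "\<kappa> a \<noteq> \<kappa> b" if "\<kappa> \<in> P M" for \<kappa>
          using that by (simp add: P_def proper_colourings_def)
        thus ?thesis by (fastforce simp: Q_def)
      qed
      \<comment> \<open>The first part consists of the colourings that remain proper once
        \<open>v\<close> is joined to \<open>S\<close>; the others split by the vertex of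
        \<open>S\<close> whose colour \<open>v\<close> repeats.\<close>
      have "P M = {\<kappa> \<in> P M. \<forall>a\<in>S. \<kappa> v \<noteq> \<kappa> a} \<union> (\<Union>a\<in>S. Q a M)"
        by (auto simp: Q_def)
      also have "card \<dots> = card {\<kappa> \<in> P M. \<forall>a\<in>S. \<kappa> v \<noteq> \<kappa> a} + card (\<Union>a\<in>S. Q a M)"
        by (rule card_Un_disjoint) (use finP finS in \<open>auto simp: Q_def\<close>)
      also have "card (\<Union>a\<in>S. Q a M) = (\<Sum>a\<in>S. card (Q a M))"
        by (rule card_UN_disjoint) (use finP finS disj in \<open>auto simp: Q_def\<close>)
      also have "\<dots> = card S * card (Q t M)"
        using card_Q S by (simp add: subset_iff)
      finally have "card (P M) = card {\<kappa> \<in> P M. \<forall>a\<in>S. \<kappa> v \<noteq> \<kappa> a} + card S * card (Q t M)" .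
      moreover have "{\<kappa> \<in> P M. \<forall>a\<in>S. \<kappa> v \<noteq> \<kappa> a}
          = {\<kappa> \<in> proper_colourings (V, E \<union> star_edges v S). image_mset \<kappa> (mset_set V) = M}"
        by (auto simp: proper_colourings_star P_def)
      ultimately show "mcoeff (chromatic_sym (V, E)) M
          = mcoeff (chromatic_sym (V, E \<union> star_edges v S) + mps_scale (of_nat (card S)) Y) M"
        by (simp add: mcoeff_chromatic_sym plus_mps.rep_eq mps_scale.rep_eq Y_def Abs_mps_inverse
            P_def)
    qed
  qed
qed

text \<open>The series depends affinely on \<open>card S\<close>, so it lies between its two
  extremes. Each later use takes extremes already known to be in the cone.\<close>

lemma e_cone_star:
  fixes E :: "'v set set"
  assumes "finite V" "T \<subseteq> V" "v \<in> V" "v \<notin> T"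
    and "\<And>a b. a \<in> T \<Longrightarrow> b \<in> T \<Longrightarrow> a \<noteq> b \<Longrightarrow> {a, b} \<in> E"
    and "\<And>a b u w. a \<in> T \<Longrightarrow> b \<in> T \<Longrightarrow> {u, w} \<in> E \<Longrightarrow> {transpose a b u, transpose a b w} \<in> E"
    and S: "S \<subseteq> T" "T \<noteq> {}"
    and X: "chromatic_sym (V, E) \<in> e_cone" "chromatic_sym (V, E \<union> star_edges v T) \<in> e_cone"
  shows "chromatic_sym (V, E \<union> star_edges v S) \<in> e_cone"
proof -
  obtain Y where Y: "\<And>S. S \<subseteq> T \<Longrightarrow>
    chromatic_sym (V, E) = chromatic_sym (V, E \<union> star_edges v S) + mps_scale (of_nat (card S)) Y"
    using chromatic_sym_star[OF assms(1-6)] by blast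
  \<comment> \<open>With \<open>s * card T = card S\<close> the unknown \<open>Y\<close> cancels;
    \<open>S \<subseteq> T\<close> gives \<open>s \<le> 1\<close>, so both weights are
    nonnegative.\<close>
  define s where "s = (of_nat (card S) / of_nat (card T) :: rat)"
  have finT: "finite T" by (rule finite_subset[OF assms(2,1)])
  have T0: "card T > 0" using finT S by (simp add: card_gt_0_iff)
  have s: "0 \<le> s" "s \<le> 1" "s * of_nat (card T) = of_nat (card S)"
    using T0 card_mono[OF finT S(1)] by (auto simp: s_def)
  have "chromatic_sym (V, E \<union> star_edges v S)
      = mps_scale (1 - s) (chromatic_sym (V, E)) + mps_scale s (chromatic_sym (V, E \<union> star_edges v T))"
  proof (rule mps_eqI)
    fix M
    let ?x = "mcoeff (chromatic_sym (V, E)) M" and ?y = "mcoeff Y M"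
    let ?xS = "mcoeff (chromatic_sym (V, E \<union> star_edges v S)) M"
    let ?xT = "mcoeff (chromatic_sym (V, E \<union> star_edges v T)) M"
    have xS: "?xS = ?x - of_nat (card S) * ?y" and xT: "?xT = ?x - of_nat (card T) * ?y"
      using arg_cong[OF Y[OF S(1)], of "\<lambda>f. mcoeff f M"]
        arg_cong[OF Y[OF subset_refl], of "\<lambda>f. mcoeff f M"]
      by (simp_all add: plus_mps.rep_eq mps_scale.rep_eq)
    have "?xS = (1 - s) * ?x + s * ?xT"
      unfolding xS xT s(3)[symmetric] by (simp add: algebra_simps)
    thus "?xS = mcoeff (mps_scale (1 - s) (chromatic_sym (V, E))
        + mps_scale s (chromatic_sym (V, E \<union> star_edges v T))) M"
      by (simp add: plus_mps.rep_eq mps_scale.rep_eq)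
  qed
  thus ?thesis
    using X s by (simp add: e_cone_add e_cone_scale)
qed


section \<open>Lollipops\<close>

text \<open>The lower end \<open>p - 1\<close> is the vertex from which the path hangs, so the tail
  of a lollipop includes its edge to the clique.\<close>

definition path_edges :: "nat \<Rightarrow> nat \<Rightarrow> nat set set" where
  "path_edges p q = (\<lambda>i. {i - 1, i}) ` {p..q}"

lemma path_edges_rec: "p \<le> q \<Longrightarrow> path_edges p q = insert {p - 1, p} (path_edges (Suc p) q)"
  by (simp add: path_edges_def Icc_eq_insert_lb_nat)

lemma clique_edges_insert: "v \<notin> C \<Longrightarrow> clique_edges (insert v C) = clique_edges C \<union> star_edges v C"
  by (auto simp: clique_edges_def star_edges_def)

lemma Union_clique_edges: "\<Union>(clique_edges C) \<subseteq> C"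
  by (auto simp: clique_edges_def)

lemma clique_edges_singleton [simp]: "clique_edges {v} = {}"
  by (auto simp: clique_edges_def)

lemma Union_path_edges: "\<Union>(path_edges p q) \<subseteq> {p - 1..q}"
  by (auto simp: path_edges_def)

text \<open>A transposition within \<open>C\<close> permutes the clique edges, and one within
  \<open>T\<close> fixes every edge of \<open>F\<close>. \<open>T\<close> may be smaller than
  \<open>C\<close>, to leave out a clique vertex that carries the tail.\<close>

lemma transpose_clique_edges:
  assumes "T \<subseteq> C" "T \<inter> \<Union>F = {}" "a \<in> T" "b \<in> T" "{u, w} \<in> clique_edges C \<union> F"
  shows "{transpose a b u, transpose a b w} \<in> clique_edges C \<union> F"
proof (cases "{u, w} \<in> F")
  case True
  hence "transpose a b u = u" "transpose a b w = w"
    using assms by (auto simp: transpose_def)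
  thus ?thesis using True by simp
next
  case False
  thus ?thesis
    using assms by (auto simp: doubleton_in_clique_edges transpose_def)
qed

text \<open>The offset \<open>a\<close> lets the induction also cover a detached tail, which is a
  shifted lollipop with a one-vertex clique.\<close>

lemma lollipop_in_e_cone:
  assumes "m \<ge> 1"
  shows "chromatic_sym ({a + 1..a + m + n},
    clique_edges {a + 1..a + m} \<union> path_edges (a + m + 1) (a + m + n)) \<in> e_cone"
  using assms
proof (induction n arbitrary: a m)
  case 0
  thus ?case by (simp add: path_edges_def clique_in_e_cone)
next
  case (Suc n)
  define C where "C = {a + 1..a + m}"
  define V where "V = {a + 1..a + m + Suc n}"
  \<comment> \<open>\<open>v\<close> is the first tail vertex, and \<open>E\<close> lacks only its
    edge to the clique.\<close>
  define v where "v = a + m + 1"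
  define E where "E = clique_edges C \<union> path_edges (v + 1) (a + m + Suc n)"
  have F: "C \<inter> \<Union>(path_edges (v + 1) (a + m + Suc n)) = {}"
    using Union_path_edges[of "v + 1" "a + m + Suc n"] by (auto simp: C_def v_def)
  have "chromatic_sym (V, E \<union> star_edges v {a + m}) \<in> e_cone"
  proof (rule e_cone_star[of V C])
    \<comment> \<open>No edge from \<open>v\<close> to \<open>C\<close>: a clique beside a
      path.\<close>
    have "chromatic_sym (C \<union> {v..a + m + Suc n},
        clique_edges C \<union> path_edges (v + 1) (a + m + Suc n)) \<in> e_cone"
    proof (rule e_cone_disjoint_union)
      show "chromatic_sym (C, clique_edges C) \<in> e_cone"
        by (rule clique_in_e_cone) (use Suc.prems in \<open>auto simp: C_def\<close>)
      show "chromatic_sym ({v..a + m + Suc n}, path_edges (v + 1) (a + m + Suc n)) \<in> e_cone"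
        using Suc.IH[of 1 "a + m"] by (simp add: v_def)
    qed (use Union_clique_edges[of C] Union_path_edges[of "v + 1" "a + m + Suc n"]
      in \<open>auto simp: C_def v_def\<close>)
    moreover have "C \<union> {v..a + m + Suc n} = V"
      by (auto simp: C_def V_def v_def)
    ultimately show "chromatic_sym (V, E) \<in> e_cone"
      by (simp add: E_def)
    \<comment> \<open>All edges from \<open>v\<close> to \<open>C\<close>: the clique grows by
      \<open>v\<close> and the tail shrinks by one, so the induction hypothesis applies.\<close>
    have "insert v C = {a + 1..a + Suc m}"
      by (auto simp: C_def v_def)
    moreover have "v \<notin> C" by (auto simp: C_def v_def)
    ultimately have "E \<union> star_edges v C
        = clique_edges {a + 1..a + Suc m} \<union> path_edges (v + 1) (a + m + Suc n)"
      using clique_edges_insert[of v C] by (auto simp: E_def)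
    thus "chromatic_sym (V, E \<union> star_edges v C) \<in> e_cone"
      using Suc.IH[of "Suc m" a] by (simp add: V_def v_def)
    show "{transpose b c u, transpose b c w} \<in> E" if "b \<in> C" "c \<in> C" "{u, w} \<in> E" for b c u w
      using transpose_clique_edges[OF subset_refl F that(1,2)] that by (simp add: E_def)
  qed (use Suc.prems in \<open>auto simp: V_def C_def v_def E_def doubleton_in_clique_edges\<close>)
  moreover have "E \<union> star_edges v {a + m} = clique_edges C \<union> path_edges v (a + m + Suc n)"
    using path_edges_rec[of v "a + m + Suc n"]
    by (auto simp: E_def star_edges_def v_def insert_commute)
  ultimately show ?case by (simp add: V_def C_def v_def)
qed

section \<open>From lollipops to melting lollipops\<close>

lemma lollipop_clique_edges:
  fixes m :: nat
  shows "{{i, j} | i j. 1 \<le> i \<and> i < j \<and> j \<le> m} = clique_edges {1..m}"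
proof
  show "clique_edges {1..m} \<subseteq> {{i, j} | i j. 1 \<le> i \<and> i < j \<and> j \<le> m}"
  proof
    fix e assume "e \<in> clique_edges {1..m}"
    then obtain i j where "e = {i, j}" "i \<in> {1..m}" "j \<in> {1..m}" "i \<noteq> j"
      by (auto simp: clique_edges_def)
    hence "e = {min i j, max i j} \<and> 1 \<le> min i j \<and> min i j < max i j \<and> max i j \<le> m"
      by (auto simp: min_def max_def)
    thus "e \<in> {{i, j} | i j. 1 \<le> i \<and> i < j \<and> j \<le> m}"
      unfolding mem_Collect_eq by - (rule exI, rule exI)
  qed
qed (auto simp: doubleton_in_clique_edges)

lemma star_edges_Diff: "star_edges v S - star_edges v T = star_edges v (S - T)"
proof -
  have "inj (\<lambda>a. {v, a})" by (auto simp: inj_on_def doubleton_eq_iff)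
  thus ?thesis unfolding star_edges_def by (rule image_set_diff [symmetric])
qed

text \<open>Isolates the edges at vertex 1 as a star, the shape that \<open>e_cone_star\<close>
  handles.\<close>

lemma snd_melting_lollipop:
  assumes "m \<ge> 3"
  shows "snd (melting_lollipop m n k)
    = clique_edges {2..m} \<union> path_edges (m + 1) (m + n) \<union> star_edges 1 {2..m - k}"
proof -
  define D where "D = star_edges 1 {m - k + 1..m}"
  \<comment> \<open>Every deleted edge contains vertex 1, so only the star at 1 is affected.\<close>
  have avoid: "A - D = A" if "1 \<notin> \<Union>A" for A
    using that by (auto simp: D_def star_edges_def)
  have "{1..m} = insert 1 {2..m}" using assms by auto
  hence K: "clique_edges {1..m} = clique_edges {2..m} \<union> star_edges 1 {2..m}"
    by (simp add: clique_edges_insert)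
  have P: "{{i - 1, i} | i. m + 1 \<le> i \<and> i \<le> m + n} = path_edges (m + 1) (m + n)"
    by (auto simp: path_edges_def)
  have D: "{{1, j} | j. m - k + 1 \<le> j \<and> j \<le> m} = D"
    by (auto simp: D_def star_edges_def)
  have KD: "clique_edges {2..m} - D = clique_edges {2..m}"
    by (rule avoid) (use Union_clique_edges[of "{2..m}"] in auto)
  have PD: "path_edges (m + 1) (m + n) - D = path_edges (m + 1) (m + n)"
    by (rule avoid) (use Union_path_edges[of "m + 1" "m + n"] assms in auto)
  have "{2..m} - {m - k + 1..m} = {2..m - k}" by auto
  hence SD: "star_edges 1 {2..m} - D = star_edges 1 {2..m - k}"
    by (simp add: D_def star_edges_Diff)
  show ?thesis
    unfolding melting_lollipop_def delete_edges_def lollipop_def snd_conv lollipop_clique_edges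
      K P D Un_Diff KD PD SD by (simp only: Un_ac)
qed

text \<open>This is the case \<open>k = 1\<close>, written with the star at \<open>m\<close> instead
  of 1; it is the upper extreme for all other \<open>k\<close>.\<close>

lemma lollipop_minus_edge_in_e_cone:
  assumes "m \<ge> 3"
  shows "chromatic_sym ({1..m + n}, clique_edges {1..m - 1} \<union> path_edges (m + 1) (m + n)
    \<union> star_edges m {2..m - 1}) \<in> e_cone"
proof (rule e_cone_star[of _ "{1..m - 1}"])
  let ?C = "{1..m - 1}" and ?F = "path_edges (m + 1) (m + n)"
  have F: "?C \<inter> \<Union>?F = {}"
    using Union_path_edges[of "m + 1" "m + n"] by fastforce
  have "chromatic_sym (?C \<union> {m..m + n}, clique_edges ?C \<union> ?F) \<in> e_cone"
  proof (rule e_cone_disjoint_union)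
    show "chromatic_sym (?C, clique_edges ?C) \<in> e_cone"
      by (rule clique_in_e_cone) (use assms in auto)
    show "chromatic_sym ({m..m + n}, ?F) \<in> e_cone"
      using lollipop_in_e_cone[of 1 "m - 1" n] assms by simp
  qed (use Union_clique_edges[of ?C] Union_path_edges[of "m + 1" "m + n"] in auto)
  moreover have "?C \<union> {m..m + n} = {1..m + n}"
    using assms by auto
  ultimately show "chromatic_sym ({1..m + n}, clique_edges ?C \<union> ?F) \<in> e_cone"
    by simp
  \<comment> \<open>Joining \<open>m\<close> to all of \<open>?C\<close> restores the full
    lollipop.\<close>
  have "insert m ?C = {1..m}" "m \<notin> ?C"
    using assms by auto
  hence "clique_edges ?C \<union> ?F \<union> star_edges m ?C = clique_edges {1..m} \<union> ?F"
    using clique_edges_insert[of m ?C] by auto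
  thus "chromatic_sym ({1..m + n}, clique_edges ?C \<union> ?F \<union> star_edges m ?C) \<in> e_cone"
    using lollipop_in_e_cone[of m 0 n] assms by simp
  show "{transpose b c u, transpose b c w} \<in> clique_edges ?C \<union> ?F"
    if "b \<in> ?C" "c \<in> ?C" "{u, w} \<in> clique_edges ?C \<union> ?F" for b c u w
    using transpose_clique_edges[OF subset_refl F that] .
qed (use assms in \<open>auto simp: doubleton_in_clique_edges\<close>)

theorem proposition3p6:
  fixes m n k :: nat
  assumes "m \<ge> 3" and "n \<ge> 1" and "1 \<le> k" and "k \<le> m - 1"
  shows "e_positive (melting_lollipop m n k)"
proof -
  \<comment> \<open>\<open>?T\<close> omits \<open>m\<close>: that vertex carries the tail and is
    not interchangeable with the others. Since \<open>1 \<le> k\<close>, the neighbours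
    \<open>{2..m - k}\<close> of vertex 1 lie in \<open>?T\<close>.\<close>
  let ?C = "{2..m}" and ?T = "{2..m - 1}" and ?F = "path_edges (m + 1) (m + n)"
  have F: "?T \<inter> \<Union>?F = {}"
    using Union_path_edges[of "m + 1" "m + n"] by fastforce
  have "chromatic_sym ({1..m + n}, clique_edges ?C \<union> ?F \<union> star_edges 1 {2..m - k}) \<in> e_cone"
  proof (rule e_cone_star[of _ ?T])
    \<comment> \<open>With no edge at 1, the graph is an isolated vertex beside a lollipop with
      clique \<open>{2..m}\<close>.\<close>
    have "chromatic_sym ({1} \<union> {2..m + n}, {} \<union> (clique_edges ?C \<union> ?F)) \<in> e_cone"
    proof (rule e_cone_disjoint_union)
      show "chromatic_sym ({1}, {}) \<in> e_cone"
        using clique_in_e_cone[of "{1}"] by simp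
      show "chromatic_sym ({2..m + n}, clique_edges ?C \<union> ?F) \<in> e_cone"
        using lollipop_in_e_cone[of "m - 1" 1 n] assms by (simp add: numeral_2_eq_2)
      show "\<Union>(clique_edges ?C \<union> ?F) \<subseteq> {2..m + n}"
        using Union_clique_edges[of ?C] Union_path_edges[of "m + 1" "m + n"] assms by fastforce
    qed auto
    moreover have "{1} \<union> {2..m + n} = {1..m + n}"
      using assms by auto
    ultimately show "chromatic_sym ({1..m + n}, clique_edges ?C \<union> ?F) \<in> e_cone"
      by simp
    have "insert m ?T = ?C" "m \<notin> ?T" "insert 1 ?T = {1..m - 1}" "1 \<notin> ?T"
      using assms by auto
    \<comment> \<open>Both sides are the complete graph on \<open>{1..m}\<close> without the edge
      \<open>{1, m}\<close>, built from either end of that edge.\<close>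
    hence eq: "clique_edges ?C \<union> star_edges 1 ?T = clique_edges {1..m - 1} \<union> star_edges m ?T"
      using clique_edges_insert[of m ?T] clique_edges_insert[of 1 ?T] by auto
    have "clique_edges ?C \<union> ?F \<union> star_edges 1 ?T
        = clique_edges ?C \<union> star_edges 1 ?T \<union> ?F"
      by (simp only: Un_ac)
    also have "\<dots> = clique_edges {1..m - 1} \<union> ?F \<union> star_edges m ?T"
      unfolding eq by (simp only: Un_ac)
    finally show "chromatic_sym ({1..m + n}, clique_edges ?C \<union> ?F \<union> star_edges 1 ?T) \<in> e_cone"
      using lollipop_minus_edge_in_e_cone[OF assms(1), of n] by simp
    show "{transpose b c u, transpose b c w} \<in> clique_edges ?C \<union> ?F"
      if "b \<in> ?T" "c \<in> ?T" "{u, w} \<in> clique_edges ?C \<union> ?F" for b c u w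
      by (rule transpose_clique_edges[OF _ F that]) auto
  qed (use assms in \<open>auto simp: doubleton_in_clique_edges\<close>)
  moreover have "melting_lollipop m n k
      = ({1..m + n}, clique_edges ?C \<union> ?F \<union> star_edges 1 {2..m - k})"
    using snd_melting_lollipop[OF assms(1), of n k]
    by (simp add: prod_eq_iff) (simp add: melting_lollipop_def delete_edges_def lollipop_def)
  ultimately show ?thesis
    by (simp add: e_positiveI)
qed

end
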